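(* Let $(G,\alpha,\beta,m,\varepsilon,i,G_0)$ be a groupoid, and write $x\cdot y=m(x,y)$ for $(x,y)\in G_{(2)}$. Suppose $G$ and $G_0$ are endowed with binary operations, both denoted $\oplus$, such that: (i) $(G,\oplus)$ and $(G_0,\oplus)$ are groups; (ii) $\alpha,\beta:(G,\oplus)\to(G_0,\oplus)$, $\varepsilon:(G_0,\oplus)\to(G,\oplus)$ and $i:(G,\oplus)\to(G,\oplus)$ are morphisms of groups; (iii) the interchange law holds: $(x\cdot y)\oplus(z\cdot t)=(x\oplus z)\cdot(y\oplus t)$ for all $(x,y),(z,t)\in G_{(2)}$. Then $(G,\alpha,\beta,m,\varepsilon,i,\oplus,G_0)$ is a group-groupoid.
   Context: **Groupoid.** A groupoid $G$ over $G_0$, written $(G,\alpha,\beta,m,\varepsilon,i,G_0)$ or $(G,G_0)$, is a pair of sets $(G,G_0)$ with surjective maps $\alpha,\beta:G\to G_0$ (source, target), a partial multiplication $m:G_{(2)}:=\{(x,y)\in G\times G\mid \beta(x)=\alpha(y)\}\to G$, $m(x,y)=x\cdot y$, an injective map $\varepsilon:G_0\to G$ and a map $i:G\to G$, $i(x)=x^{-1}$, such that: (G1) if $(x,y),(y,z)\in G_{(2)}$ then $(x\cdot y,z),(x,y\cdot z)\in G_{(2)}$ and $(x\cdot y)\cdot z=x\cdot(y\cdot z)$; (G2) for each $x\in G$, $(\varepsilon(\alpha(x)),x),(x,\varepsilon(\beta(x)))\in G_{(2)}$ and $\varepsilon(\alpha(x))\cdot x=x=x\cdot\varepsilon(\beta(x))$;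 (G3) for each $x\in G$, $(x^{-1},x),(x,x^{-1})\in G_{(2)}$, $x^{-1}\cdot x=\varepsilon(\beta(x))$ and $x\cdot x^{-1}=\varepsilon(\alpha(x))$. Note that composition is written left to right. **Groupoid morphism.** A morphism $(G,G_0)\to(G',G_0')$ is a pair of maps $f:G\to G'$, $f_0:G_0\to G_0'$ with $\alpha'\circ f=f_0\circ\alpha$, $\beta'\circ f=f_0\circ\beta$ and $f(m(x,y))=m'(f(x),f(y))$ for all $(x,y)\in G_{(2)}$. **Direct product and null groupoid.** $(G\times G,G_0\times G_0)$ is the direct product groupoid, with componentwise structure functions. A singleton $\{\lambda\}$ is regarded as the null groupoid $(\{\lambda\},\{\lambda\})$ (all structure functions are identities and $\lambda\cdot\lambda=\lambda$). **Group-groupoid.** Suppose $G$ carries a group structure with operation $\omega(x,y)=x\oplus y$, unit map $\nu:\{\lambda\}\to G$, $\nu(\lambda)=e$, and inverse map $\sigma(x)=\bar x$, and $G_0$ carries a group structure with operation $\omega_0(u,v)=u\oplus v$, unit map $\nu_0:\{\lambda\}\to G_0$, $\nu_0(\lambda)=e_0$, and inverse map $\sigma_0(u)=\bar u$. The groupoid $(G,G_0)$ with these group structures is a group-groupoid if $(\omega,\omega_0):(G\times G,G_0\times G_0)\to(G,G_0)$, $(\nu,\nu_0):(\{\lambda\},\{\lambda\})\to(G,G_0)$ and $(\sigma,\sigma_0):(G,G_0)\to(G,G_0)$ are groupoid morphisms. *)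

theory Defs
  imports "HOL-Algebra.Group"
begin

text \<open>
  The fields are total functions on types; only their values on \<open>arrows\<close>, \<open>objects\<close> and,
  for \<open>gcomp\<close>, on composable pairs are meaningful. Composition is written from left to
  right: \<open>x \<cdot> y\<close> is meaningful when the target of \<open>x\<close> is the source of \<open>y\<close>.
\<close>

record ('a, 'o) groupoid_data =
  arrows :: "'a set"
  objects :: "'o set"
  src :: "'a \<Rightarrow> 'o"
  tgt :: "'a \<Rightarrow> 'o"
  gcomp :: "'a \<Rightarrow> 'a \<Rightarrow> 'a" (infixl "\<cdot>\<index>" 70)
  ident :: "'o \<Rightarrow> 'a"
  ginv :: "'a \<Rightarrow> 'a"

definition composable :: "('a, 'o) groupoid_data \<Rightarrow> ('a \<times> 'a) set" where
  "composable G = {(x, y) \<in> arrows G \<times> arrows G. tgt G x = src G y}"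

locale groupoid =
  fixes G :: "('a, 'o) groupoid_data" (structure)
  assumes src_surj: "src G ` arrows G = objects G"
    and tgt_surj: "tgt G ` arrows G = objects G"
    and comp_closed: "(x, y) \<in> composable G \<Longrightarrow> x \<cdot> y \<in> arrows G"
    and ident_closed: "ident G \<in> objects G \<rightarrow> arrows G"
    and ident_inj: "inj_on (ident G) (objects G)"
    and ginv_closed: "ginv G \<in> arrows G \<rightarrow> arrows G"
    and assoc: "(x, y) \<in> composable G \<Longrightarrow> (y, z) \<in> composable G \<Longrightarrow>
      (x \<cdot> y, z) \<in> composable G \<and> (x, y \<cdot> z) \<in> composable G \<and>
      (x \<cdot> y) \<cdot> z = x \<cdot> (y \<cdot> z)"
    and units: "x \<in> arrows G \<Longrightarrow>
      (ident G (src G x), x) \<in> composable G \<and> (x, ident G (tgt G x)) \<in> composable G \<and>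
      ident G (src G x) \<cdot> x = x \<and> x \<cdot> ident G (tgt G x) = x"
    and inverses: "x \<in> arrows G \<Longrightarrow>
      (ginv G x, x) \<in> composable G \<and> (x, ginv G x) \<in> composable G \<and>
      ginv G x \<cdot> x = ident G (tgt G x) \<and> x \<cdot> ginv G x = ident G (src G x)"

locale groupoid_morphism = source: groupoid G + target: groupoid H
  for G :: "('a, 'o) groupoid_data" and H :: "('b, 'p) groupoid_data"
    and f :: "'a \<Rightarrow> 'b" and f\<^sub>0 :: "'o \<Rightarrow> 'p" +
  assumes arrows_map: "f \<in> arrows G \<rightarrow> arrows H"
    and objects_map: "f\<^sub>0 \<in> objects G \<rightarrow> objects H"
    and src_commutes: "x \<in> arrows G \<Longrightarrow> src H (f x) = f\<^sub>0 (src G x)"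
    and tgt_commutes: "x \<in> arrows G \<Longrightarrow> tgt H (f x) = f\<^sub>0 (tgt G x)"
    and comp_preserved: "(x, y) \<in> composable G \<Longrightarrow> f (x \<cdot>\<^bsub>G\<^esub> y) = f x \<cdot>\<^bsub>H\<^esub> f y"

definition prod_groupoid ::
  "('a, 'o) groupoid_data \<Rightarrow> ('b, 'p) groupoid_data \<Rightarrow> ('a \<times> 'b, 'o \<times> 'p) groupoid_data"
where
  "prod_groupoid G H =
    \<lparr> arrows = arrows G \<times> arrows H,
      objects = objects G \<times> objects H,
      src = (\<lambda>(x, y). (src G x, src H y)),
      tgt = (\<lambda>(x, y). (tgt G x, tgt H y)),
      gcomp = (\<lambda>(x, y) (z, t). (x \<cdot>\<^bsub>G\<^esub> z, y \<cdot>\<^bsub>H\<^esub> t)),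
      ident = (\<lambda>(u, v). (ident G u, ident H v)),
      ginv = (\<lambda>(x, y). (ginv G x, ginv H y)) \<rparr>"

definition null_groupoid :: "'l \<Rightarrow> ('l, 'l) groupoid_data" where
  "null_groupoid l =
    \<lparr> arrows = {l}, objects = {l}, src = id, tgt = id,
      gcomp = (\<lambda>_ _. l), ident = id, ginv = id \<rparr>"

lemma groupoid_prod_groupoid:
  assumes "groupoid G" "groupoid H"
  shows "groupoid (prod_groupoid G H)"
proof -
  interpret G: groupoid G by fact
  interpret H: groupoid H by fact
  have fields:
    "arrows (prod_groupoid G H) = arrows G \<times> arrows H"
    "objects (prod_groupoid G H) = objects G \<times> objects H"
    "src (prod_groupoid G H) = (\<lambda>(x, y). (src G x, src H y))"
    "tgt (prod_groupoid G H) = (\<lambda>(x, y). (tgt G x, tgt H y))"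
    "gcomp (prod_groupoid G H) (a, b) (c, d) = (a \<cdot>\<^bsub>G\<^esub> c, b \<cdot>\<^bsub>H\<^esub> d)"
    "ident (prod_groupoid G H) = (\<lambda>(u, v). (ident G u, ident H v))"
    "ginv (prod_groupoid G H) = (\<lambda>(x, y). (ginv G x, ginv H y))" for a b c d
    by (simp_all add: prod_groupoid_def)
  have comp: "((x, y), (z, t)) \<in> composable (prod_groupoid G H) \<longleftrightarrow>
      (x, z) \<in> composable G \<and> (y, t) \<in> composable H" for x y z t
    by (auto simp: composable_def fields)
  show ?thesis
  proof (unfold_locales, goal_cases)
    case 1
    have "(\<lambda>(x, y). (src G x, src H y)) ` (arrows G \<times> arrows H) =
        (src G ` arrows G) \<times> (src H ` arrows H)"
      by auto
    then show ?case
      by (simp only: fields G.src_surj H.src_surj)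
  next
    case 2
    have "(\<lambda>(x, y). (tgt G x, tgt H y)) ` (arrows G \<times> arrows H) =
        (tgt G ` arrows G) \<times> (tgt H ` arrows H)"
      by auto
    then show ?case
      by (simp only: fields G.tgt_surj H.tgt_surj)
  next
    case (3 x y)
    then show ?case
      by (cases x; cases y) (simp add: comp fields G.comp_closed H.comp_closed)
  next
    case 4
    show ?case
      using G.ident_closed H.ident_closed unfolding fields by (simp add: Pi_iff)
  next
    case 5
    show ?case
      using G.ident_inj H.ident_inj unfolding fields by (simp add: inj_on_def)
  next
    case 6
    show ?case
      using G.ginv_closed H.ginv_closed unfolding fields by (simp add: Pi_iff)
  next
    case (7 x y z)
    obtain x1 x2 y1 y2 z1 z2 where eq: "x = (x1, x2)" "y = (y1, y2)" "z = (z1, z2)"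
      by (cases x; cases y; cases z)
    with 7 have "(x1, y1) \<in> composable G" "(y1, z1) \<in> composable G"
      "(x2, y2) \<in> composable H" "(y2, z2) \<in> composable H"
      by (simp_all add: comp)
    with G.assoc[of x1 y1 z1] H.assoc[of x2 y2 z2] show ?case
      unfolding eq fields comp by simp
  next
    case (8 x)
    obtain x1 x2 where eq: "x = (x1, x2)"
      by (cases x)
    with 8 have "x1 \<in> arrows G" "x2 \<in> arrows H"
      by (simp_all add: fields)
    with G.units[of x1] H.units[of x2] show ?case
      unfolding eq fields comp prod.case by simp
  next
    case (9 x)
    obtain x1 x2 where eq: "x = (x1, x2)"
      by (cases x)
    with 9 have "x1 \<in> arrows G" "x2 \<in> arrows H"
      by (simp_all add: fields)
    with G.inverses[of x1] H.inverses[of x2] show ?case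
      unfolding eq fields comp prod.case by simp
  qed
qed

lemma groupoid_null_groupoid: "groupoid (null_groupoid l)"
proof -
  have "(x, y) \<in> composable (null_groupoid l) \<longleftrightarrow> x = l \<and> y = l" for x y
    by (simp add: composable_def null_groupoid_def) blast
  moreover have "arrows (null_groupoid l) = {l}" "objects (null_groupoid l) = {l}"
    "src (null_groupoid l) = id" "tgt (null_groupoid l) = id"
    "gcomp (null_groupoid l) x y = l"
    "ident (null_groupoid l) = id" "ginv (null_groupoid l) = id" for x y
    by (simp_all add: null_groupoid_def)
  ultimately show ?thesis
    by unfold_locales simp_all
qed

text \<open>
  The two group structures are given by \<open>A\<close> on the arrows and \<open>B\<close> on the objects. The
  operation \<open>\<oplus>\<close> of the mathematical text is the (multiplicatively written, possibly
  non-commutative) operation \<open>\<otimes>\<close> of \<open>A\<close> and of \<open>B\<close>.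
\<close>

locale group_groupoid = groupoid G + arrow_group: group A + object_group: group B
  for G :: "('a, 'o) groupoid_data" and A :: "'a monoid" and B :: "'o monoid" +
  assumes carrier_arrows: "carrier A = arrows G"
    and carrier_objects: "carrier B = objects G"
    and op_morphism: "groupoid_morphism (prod_groupoid G G) G
      (\<lambda>(x, y). x \<otimes>\<^bsub>A\<^esub> y) (\<lambda>(u, v). u \<otimes>\<^bsub>B\<^esub> v)"
    and unit_morphism: "groupoid_morphism (null_groupoid ()) G
      (\<lambda>_. \<one>\<^bsub>A\<^esub>) (\<lambda>_. \<one>\<^bsub>B\<^esub>)"
    and inv_morphism: "groupoid_morphism G G (m_inv A) (m_inv B)"

end

theory Submission
  imports Defs
begin

text \<open>
  Interchange, together with \<open>\<alpha>\<close> and \<open>\<beta>\<close> being homomorphisms, is exactly the assertion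
  that the group operation is a groupoid morphism. The two remaining morphisms come from
  the fact that the group unit \<open>e\<close> is an identity arrow: it is \<open>\<epsilon>(e\<^sub>0)\<close>, because \<open>\<epsilon>\<close>
  preserves units. Hence \<open>e \<cdot> e = e\<close> (\<open>hom_one_comp_one\<close>), which makes the unit map a
  morphism. Writing \<open>x'\<close> for the group inverse of \<open>x\<close>, interchange gives
  \<open>(x' \<cdot> y') \<oplus> (x \<cdot> y) = (x' \<oplus> x) \<cdot> (y' \<oplus> y) = e \<cdot> e = e\<close>,
  so that \<open>x' \<cdot> y'\<close> is the group inverse of \<open>x \<cdot> y\<close> (\<open>m_inv_comp\<close>); the left-hand
  side makes sense because \<open>\<alpha>\<close> and \<open>\<beta>\<close> preserve group inverses
  (\<open>composable_m_inv\<close>).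
\<close>

text \<open>The unit law for \<open>e = \<epsilon>(\<alpha>(e))\<close>.\<close>

lemma (in groupoid) hom_one_comp_one:
  assumes "group A" "carrier A = arrows G" "group B" "carrier B = objects G"
    and src_hom: "src G \<in> hom A B" and ident_hom: "ident G \<in> hom B A"
  shows "\<one>\<^bsub>A\<^esub> \<cdot> \<one>\<^bsub>A\<^esub> = \<one>\<^bsub>A\<^esub>"
proof -
  interpret A: group A by fact
  have "ident G (src G \<one>\<^bsub>A\<^esub>) = \<one>\<^bsub>A\<^esub>"
    using hom_one[OF src_hom] hom_one[OF ident_hom] assms by simp
  with units[of "\<one>\<^bsub>A\<^esub>"] show ?thesis
    using A.one_closed assms(2) by simp
qed

lemma composable_m_inv:
  assumes "group A" "carrier A = arrows G" "group B"
    and src_hom: "src G \<in> hom A B" and tgt_hom: "tgt G \<in> hom A B"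
    and xy: "(x, y) \<in> composable G"
  shows "(inv\<^bsub>A\<^esub> x, inv\<^bsub>A\<^esub> y) \<in> composable G"
proof -
  interpret A: group A by fact
  interpret S: group_hom A B "src G"
    using assms by (simp add: group_hom_def group_hom_axioms_def)
  interpret T: group_hom A B "tgt G"
    using assms by (simp add: group_hom_def group_hom_axioms_def)
  from xy have "x \<in> carrier A" "y \<in> carrier A" "tgt G x = src G y"
    by (simp_all add: composable_def \<open>carrier A = arrows G\<close>)
  moreover from this have "inv\<^bsub>A\<^esub> x \<in> carrier A" "inv\<^bsub>A\<^esub> y \<in> carrier A"
    by simp_all
  ultimately show ?thesis
    by (simp add: composable_def flip: \<open>carrier A = arrows G\<close>)
qed

text \<open>
  The order of the factors is kept, although inversion in a group reverses products:
  \<open>\<cdot>\<close> interchanges with the group operation, so a composite is inverted factor by factor.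
\<close>

lemma (in groupoid) m_inv_comp:
  assumes "group A" "carrier A = arrows G" "group B" "carrier B = objects G"
    and src_hom: "src G \<in> hom A B" and tgt_hom: "tgt G \<in> hom A B"
    and ident_hom: "ident G \<in> hom B A"
    and interchange: "\<And>x y z t. (x, y) \<in> composable G \<Longrightarrow> (z, t) \<in> composable G \<Longrightarrow>
      (x \<cdot> y) \<otimes>\<^bsub>A\<^esub> (z \<cdot> t) = (x \<otimes>\<^bsub>A\<^esub> z) \<cdot> (y \<otimes>\<^bsub>A\<^esub> t)"
    and xy: "(x, y) \<in> composable G"
  shows "inv\<^bsub>A\<^esub> (x \<cdot> y) = inv\<^bsub>A\<^esub> x \<cdot> inv\<^bsub>A\<^esub> y"
proof -
  interpret A: group A by fact
  from xy have mem: "x \<in> carrier A" "y \<in> carrier A"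
    by (simp_all add: composable_def \<open>carrier A = arrows G\<close>)
  have inv_xy: "(inv\<^bsub>A\<^esub> x, inv\<^bsub>A\<^esub> y) \<in> composable G"
    using composable_m_inv[OF assms(1-3) src_hom tgt_hom xy] .
  have "(inv\<^bsub>A\<^esub> x \<cdot> inv\<^bsub>A\<^esub> y) \<otimes>\<^bsub>A\<^esub> (x \<cdot> y) =
      (inv\<^bsub>A\<^esub> x \<otimes>\<^bsub>A\<^esub> x) \<cdot> (inv\<^bsub>A\<^esub> y \<otimes>\<^bsub>A\<^esub> y)"
    using interchange[OF inv_xy xy] .
  also have "\<dots> = \<one>\<^bsub>A\<^esub>"
    using mem hom_one_comp_one[OF assms(1-4) src_hom ident_hom] by simp
  finally show ?thesis
    using A.inv_equality comp_closed[OF xy] comp_closed[OF inv_xy]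
    by (simp add: \<open>carrier A = arrows G\<close>)
qed

theorem theorem3p1:
  fixes G :: "('a, 'o) groupoid_data" and A :: "'a monoid" and B :: "'o monoid"
  assumes groupoid: "groupoid G"
    and arrow_group: "group A" "carrier A = arrows G"
    and object_group: "group B" "carrier B = objects G"
    and src_hom: "src G \<in> hom A B"
    and tgt_hom: "tgt G \<in> hom A B"
    and ident_hom: "ident G \<in> hom B A"
    and ginv_hom: "ginv G \<in> hom A A"
    and interchange: "\<And>x y z t. (x, y) \<in> composable G \<Longrightarrow> (z, t) \<in> composable G \<Longrightarrow>
      (x \<cdot>\<^bsub>G\<^esub> y) \<otimes>\<^bsub>A\<^esub> (z \<cdot>\<^bsub>G\<^esub> t) = (x \<otimes>\<^bsub>A\<^esub> z) \<cdot>\<^bsub>G\<^esub> (y \<otimes>\<^bsub>A\<^esub> t)"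
  shows "group_groupoid G A B"
proof -
  interpret groupoid G by fact
  interpret A: group A by fact
  interpret B: group B by fact
  interpret S: group_hom A B "src G"
    using src_hom by unfold_locales
  interpret T: group_hom A B "tgt G"
    using tgt_hom by unfold_locales
  note carriers = arrow_group(2)[symmetric] object_group(2)[symmetric]
  have op: "groupoid_morphism (prod_groupoid G G) G
      (\<lambda>(x, y). x \<otimes>\<^bsub>A\<^esub> y) (\<lambda>(u, v). u \<otimes>\<^bsub>B\<^esub> v)"
  proof (intro groupoid_morphism.intro groupoid_morphism_axioms.intro)
    fix p q
    assume pq: "(p, q) \<in> composable (prod_groupoid G G)"
    obtain x z y t where eq: "p = (x, z)" "q = (y, t)"
      by (cases p; cases q)
    with pq have "(x, y) \<in> composable G" "(z, t) \<in> composable G"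
      by (simp_all add: composable_def prod_groupoid_def)
    from interchange[OF this]
    show "(\<lambda>(x, y). x \<otimes>\<^bsub>A\<^esub> y) (p \<cdot>\<^bsub>prod_groupoid G G\<^esub> q) =
        (\<lambda>(x, y). x \<otimes>\<^bsub>A\<^esub> y) p \<cdot>\<^bsub>G\<^esub> (\<lambda>(x, y). x \<otimes>\<^bsub>A\<^esub> y) q"
      by (simp add: eq prod_groupoid_def)
  qed (use groupoid_prod_groupoid[OF groupoid groupoid] groupoid in
      \<open>auto simp: prod_groupoid_def carriers\<close>)
  have unit: "groupoid_morphism (null_groupoid ()) G (\<lambda>_. \<one>\<^bsub>A\<^esub>) (\<lambda>_. \<one>\<^bsub>B\<^esub>)"
    using hom_one_comp_one[OF arrow_group object_group src_hom ident_hom]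
    by (intro groupoid_morphism.intro groupoid_morphism_axioms.intro)
      (simp_all add: groupoid groupoid_null_groupoid carriers)
  have inversion: "groupoid_morphism G G (m_inv A) (m_inv B)"
    using m_inv_comp[OF arrow_group object_group src_hom tgt_hom ident_hom interchange]
    by (intro groupoid_morphism.intro groupoid_morphism_axioms.intro)
      (simp_all add: groupoid carriers)
  show ?thesis
    by (intro group_groupoid.intro group_groupoid_axioms.intro)
      (fact groupoid arrow_group object_group op unit inversion)+
qed

end
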